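(* Suppose $\eta$ has support $\Lambda\subseteq V$, let $I_\Lambda$ be the diagonal matrix with $I_\Lambda(x,x)=1$ if $x\in\Lambda$ and $0$ otherwise, put $G_{0,\Lambda}=I_\Lambda G_0I_\Lambda$, and let $\eta_{\max}=\sup_{x\in\Lambda}\eta(x)$. If $\eta_{\max}\,\alpha_0\,\|G_{0,\Lambda}\|<1$, then the series $$B=\left[\sum_{n=0}^\infty(-1)^n\alpha_0^n(G_0D_\eta)^n\right]G_0$$ converges to the Green's function $H^{-1}$ of the perturbed problem, where $H=H_0+\alpha_0D_\eta$. Moreover, the truncation error $\|B-B_N\|$ associated with taking the first $N+1$ terms of the series, $$B_N=\left[\sum_{n=0}^N(-1)^n\alpha_0^n(G_0D_\eta)^n\right]G_0,$$ is $O\!\left(\alpha_0^N\,\|G_{0,\Lambda}\|^N\,\eta_{\max}^N\right)$ as $N\to\infty$.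
   Context: Let $\Gamma=(V',E)$ be a connected, locally finite, loop-free (undirected, simple) graph and let $V\subsetneq V'$ be a nonempty proper subset. Its vertex boundary is $\delta V=\{y\in V'\setminus V:\exists x\in V,\ x\sim y\}$, where $x\sim y$ means adjacency. Assume $p=|V|$ and $k=|\delta V|$ are finite. Let $\Sigma$ be the graph on $V\cup\delta V$ whose edges are the edges of $\Gamma$ joining two vertices of $V\cup\delta V$ at least one of which lies in $V$, and let $L$ be its combinatorial Laplacian matrix (degree in $\Sigma$ on the diagonal, $-1$ for adjacent pairs, $0$ otherwise). With vertices of $V$ listed first, for $\alpha_0>0$ and $0\le t<\infty$ put $$H_0=L+\begin{pmatrix}\alpha_0I_{p\times p}&0\\0&t\,I_{k\times k}\end{pmatrix},$$ assumed invertible, and let $G_0=H_0^{-1}$ (the background Green's function). Let $\eta:V\to\mathbb{R}_{\ge0}$ and let $D_\eta$ be the $(p+k)\times(p+k)$ diagonal matrix with entry $\eta(x)$ at each $x\in V$ and $0$ at each vertex of $\delta V$. The support of $\eta$ is the set of vertices of $V$ where $\eta\neq0$ (if it is empty, $\eta_{\max}=0$). The perturbed problem is $Hu=\tilde f$ with $H=H_0+\alpha_0D_\eta$, which encodes $\sum_yL(x,y)u(y)+\alpha_0[1+\eta(x)]u(x)=f(x)$ on $V$ and $t\,u(x)+\sum_{z\in V,\,z\sim x}[u(x)-u(z)]=g(x)$ on $\delta V$; its Green's function is $H^{-1}$. Here $\|\cdot\|$ is an operator norm induced by a vector norm for which the norm of a diagonal matrix is the largest absolute value of its diagonal entries (for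 example any $\ell^q$ norm, $1\le q\le\infty$). In the $O(\cdot)$ statement all data other than $N$ are fixed. *)

theory Defs
  imports
    "Graph_Theory.Digraph_Component"
    "HOL-Analysis.Analysis"
    "HOL-Library.Landau_Symbols"
begin

text \<open>
  An undirected, simple, possibly infinite graph is a \<^locale>\<open>pair_bidirected_digraph\<close>: a loop-free
  digraph whose arcs are pairs of vertices, with a symmetric arc set. Each undirected edge
  corresponds to two opposite arcs, so the out-degree of a vertex is its number of neighbours.
\<close>

definition locally_finite :: "'a pair_pre_digraph \<Rightarrow> bool" where
  "locally_finite \<Gamma> \<longleftrightarrow> (\<forall>x \<in> pverts \<Gamma>. finite (out_arcs (with_proj \<Gamma>) x))"

definition vertex_boundary :: "'a pair_pre_digraph \<Rightarrow> 'a set \<Rightarrow> 'a set" where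
  "vertex_boundary \<Gamma> V = {y \<in> pverts \<Gamma> - V. \<exists>x \<in> V. (x, y) \<in> parcs \<Gamma>}"

definition boundary_graph :: "'a pair_pre_digraph \<Rightarrow> 'a set \<Rightarrow> 'a pair_pre_digraph" where
  "boundary_graph \<Gamma> V =
     \<lparr> pverts = V \<union> vertex_boundary \<Gamma> V,
       parcs = {(x, y) \<in> parcs \<Gamma>. x \<in> V \<union> vertex_boundary \<Gamma> V \<and> y \<in> V \<union> vertex_boundary \<Gamma> V
                  \<and> (x \<in> V \<or> y \<in> V)} \<rparr>"

definition laplacian :: "'a pair_pre_digraph \<Rightarrow> 'a \<Rightarrow> 'a \<Rightarrow> real" where
  "laplacian \<Sigma> x y =
     (if x = y then real (out_degree (with_proj \<Sigma>) x) else if (x, y) \<in> parcs \<Sigma> then -1 else 0)"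

text \<open>
  Matrices over a finite vertex set \<open>W\<close> are represented over an index type \<open>'n\<close>, given a
  bijection \<open>v\<close> from \<open>'n\<close> onto \<open>W\<close>.
\<close>

definition laplacian_matrix :: "'a pair_pre_digraph \<Rightarrow> ('n \<Rightarrow> 'a) \<Rightarrow> real ^ 'n ^ 'n" where
  "laplacian_matrix \<Sigma> v = (\<chi> i j. laplacian \<Sigma> (v i) (v j))"

definition diagonal_matrix :: "('n \<Rightarrow> real) \<Rightarrow> real ^ 'n ^ 'n" where
  "diagonal_matrix d = (\<chi> i j. if i = j then d i else 0)"

text \<open>The type-class power on \<^typ>\<open>real ^ 'n ^ 'n\<close> is componentwise, hence the following.\<close>

definition matrix_power :: "real ^ 'n ^ 'n \<Rightarrow> nat \<Rightarrow> real ^ 'n ^ 'n" where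
  "matrix_power A n = (((**) A) ^^ n) (mat 1)"

definition is_vector_norm :: "('v::real_vector \<Rightarrow> real) \<Rightarrow> bool" where
  "is_vector_norm \<nu> \<longleftrightarrow>
     (\<forall>x. 0 \<le> \<nu> x) \<and> (\<forall>x. \<nu> x = 0 \<longleftrightarrow> x = 0) \<and>
     (\<forall>c x. \<nu> (c *\<^sub>R x) = \<bar>c\<bar> * \<nu> x) \<and> (\<forall>x y. \<nu> (x + y) \<le> \<nu> x + \<nu> y)"

text \<open>As in \<^const>\<open>onorm\<close>, the vector \<open>x = 0\<close> contributes \<open>0 / 0 = 0\<close> to the supremum.\<close>

definition induced_norm :: "(real ^ 'n \<Rightarrow> real) \<Rightarrow> real ^ 'n ^ 'n \<Rightarrow> real" where
  "induced_norm \<nu> A = (SUP x. \<nu> (A *v x) / \<nu> x)"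

lemma induced_norm_norm: "induced_norm norm A = onorm ((*v) A)"
  by (simp add: induced_norm_def onorm_def)

text \<open>For \<open>\<eta> \<ge> 0\<close>, the supremum over the empty set is by convention \<open>0\<close>.\<close>

definition sup_on :: "'a set \<Rightarrow> ('a \<Rightarrow> real) \<Rightarrow> real" where
  "sup_on \<Lambda> \<eta> = (if \<Lambda> = {} then 0 else (SUP x \<in> \<Lambda>. \<eta> x))"

end

theory Submission
  imports Defs
begin

text \<open>
  Write \<open>K = - \<alpha>\<^sub>0 G\<^sub>0 D\<^sub>\<eta>\<close>, so that \<open>H = H\<^sub>0 (1 - K)\<close>. Since \<open>D\<^sub>\<eta>\<close> is supported on \<open>\<Lambda>\<close>,
  \<open>D\<^sub>\<eta> G\<^sub>0 D\<^sub>\<eta> = D\<^sub>\<eta> G\<^sub>0\<^sub>\<Lambda> D\<^sub>\<eta>\<close>, hence \<open>(G\<^sub>0 D\<^sub>\<eta>)\<^sup>n\<^sup>+\<^sup>1 = G\<^sub>0 D\<^sub>\<eta> (G\<^sub>0\<^sub>\<Lambda> D\<^sub>\<eta>)\<^sup>n\<close> and the norm of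
  \<open>K\<^sup>n\<^sup>+\<^sup>1\<close> is at most a constant times \<open>r\<^sup>n\<close> with \<open>r = \<alpha>\<^sub>0 \<parallel>G\<^sub>0\<^sub>\<Lambda>\<parallel> \<eta>\<^sub>m\<^sub>a\<^sub>x < 1\<close>. So \<open>1 - K\<close> is
  injective, and the identity \<open>(1 - K) (1 + K + \<dots> + K\<^sup>N) = 1 - K\<^sup>N\<^sup>+\<^sup>1\<close> gives both the limit of
  the series and the exact remainder \<open>(1 - K)\<^sup>-\<^sup>1 K\<^sup>N\<^sup>+\<^sup>1 G\<^sub>0\<close>.
\<close>

section \<open>Induced norms\<close>

text \<open>Homogeneity and the triangle inequality give convexity, which serves to obtain
  continuity: a convex function on a whole Euclidean space is continuous.\<close>

lemma is_vector_norm_convex: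
  fixes \<nu> :: "'v::real_vector \<Rightarrow> real"
  assumes "is_vector_norm \<nu>"
  shows "convex_on UNIV \<nu>"
proof (rule convex_onI)
  fix s :: real and x y
  assume "0 < s" "s < 1"
  have "\<nu> ((1 - s) *\<^sub>R x + s *\<^sub>R y) \<le> \<nu> ((1 - s) *\<^sub>R x) + \<nu> (s *\<^sub>R y)"
    using assms unfolding is_vector_norm_def by blast
  also have "\<dots> = \<bar>1 - s\<bar> * \<nu> x + \<bar>s\<bar> * \<nu> y"
    using assms unfolding is_vector_norm_def by simp
  finally show "\<nu> ((1 - s) *\<^sub>R x + s *\<^sub>R y) \<le> (1 - s) * \<nu> x + s * \<nu> y"
    using \<open>0 < s\<close> \<open>s < 1\<close> by simp
qed simp

text \<open>By homogeneity it suffices to bound \<open>\<nu>\<close> on the Euclidean unit sphere.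
  This is compact, so the minimum and the maximum are attained; the minimum is positive because
  \<open>\<nu>\<close> is definite.\<close>

lemma is_vector_norm_equivalent:
  fixes \<nu> :: "'v::euclidean_space \<Rightarrow> real"
  assumes \<nu>: "is_vector_norm \<nu>"
  obtains c C where "c > 0" "\<And>x. c * norm x \<le> \<nu> x" "\<And>x. \<nu> x \<le> C * norm x"
proof -
  let ?S = "sphere (0::'v) 1"
  have cont: "continuous_on ?S \<nu>"
    using convex_on_continuous[OF open_UNIV is_vector_norm_convex[OF \<nu>]]
    by (rule continuous_on_subset) simp
  have comp: "compact ?S" and ne: "?S \<noteq> {}"
    by simp_all
  obtain a where a: "a \<in> ?S" "\<And>y. y \<in> ?S \<Longrightarrow> \<nu> a \<le> \<nu> y"
    using continuous_attains_inf[OF comp ne cont] by blast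
  obtain b where b: "b \<in> ?S" "\<And>y. y \<in> ?S \<Longrightarrow> \<nu> y \<le> \<nu> b"
    using continuous_attains_sup[OF comp ne cont] by blast
  have zero: "\<nu> 0 = 0"
    using \<nu> unfolding is_vector_norm_def by blast
  have scale: "\<nu> x = norm x * \<nu> (x /\<^sub>R norm x)" for x
  proof -
    have "\<nu> (norm x *\<^sub>R (x /\<^sub>R norm x)) = norm x * \<nu> (x /\<^sub>R norm x)"
      using \<nu> unfolding is_vector_norm_def by (metis abs_norm_cancel)
    then show ?thesis
      by (cases "x = 0") (auto simp: zero)
  qed
  have "\<nu> a * norm x \<le> \<nu> x \<and> \<nu> x \<le> \<nu> b * norm x" for x
  proof (cases "x = 0")
    case False
    then have "x /\<^sub>R norm x \<in> ?S"
      by simp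
    from a(2)[OF this] b(2)[OF this] show ?thesis
      \<comment> \<open>The occurrences 2 and 3 are the two \<open>\<nu> x\<close>; the extreme
        values \<open>\<nu> a\<close> and \<open>\<nu> b\<close> stay as they are.\<close>
      by (subst (2 3) scale) (simp add: mult.commute mult_left_mono)
  qed (simp add: zero)
  moreover have "\<nu> a > 0"
  proof -
    have "a \<noteq> 0"
      using a(1) by auto
    then show ?thesis
      using \<nu> unfolding is_vector_norm_def by (metis order_less_le)
  qed
  ultimately show thesis
    using that by blast
qed

text \<open>A real \<open>SUP\<close> is informative only for a bounded family. Equivalence with the
  Euclidean norm carries the finiteness of \<open>onorm\<close> over to \<open>\<nu>\<close>, at the
  cost of the factor \<open>C / c\<close>.\<close>

lemma induced_norm_bdd_above:
  fixes \<nu> :: "real ^ 'n::finite \<Rightarrow> real"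
  assumes "is_vector_norm \<nu>"
  shows "bdd_above (range (\<lambda>x. \<nu> (A *v x) / \<nu> x))"
proof -
  obtain c C where c: "c > 0" "\<And>x. c * norm x \<le> \<nu> x" and C: "\<And>x. \<nu> x \<le> C * norm x"
    using is_vector_norm_equivalent[OF assms] by blast
  \<comment> \<open>Any nonzero vector shows this; a unit vector at an arbitrary index will
    do.\<close>
  have Cp: "C > 0"
  proof -
    have "c * norm (axis undefined 1 :: real ^ 'n) \<le> C * norm (axis undefined 1 :: real ^ 'n)"
      using c(2) C order_trans by blast
    then show ?thesis
      using c(1) by (simp add: norm_axis_1)
  qed
  have "\<nu> (A *v x) / \<nu> x \<le> C * onorm ((*v) A) / c" for x
  proof (cases "x = 0")
    case False
    have "\<nu> (A *v x) \<le> C * (onorm ((*v) A) * norm x)"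
      using C[of "A *v x"] onorm[OF matrix_vector_mul_bounded_linear, of A x] Cp
      by (meson mult_left_mono less_imp_le order_trans)
    then have "\<nu> (A *v x) / \<nu> x \<le> C * (onorm ((*v) A) * norm x) / (c * norm x)"
      using c Cp False onorm_pos_le[OF matrix_vector_mul_bounded_linear, of A]
      by (intro frac_le) auto
    also have "\<dots> = C * onorm ((*v) A) / c"
      using False by simp
    finally show ?thesis .
  next
    case True
    then have "\<nu> x = 0"
      using assms unfolding is_vector_norm_def by blast
    then show ?thesis
      using Cp c(1) onorm_pos_le[OF matrix_vector_mul_bounded_linear, of A] by simp
  qed
  then show ?thesis
    by (rule bdd_aboveI2)
qed

lemma induced_norm_bound:
  fixes \<nu> :: "real ^ 'n::finite \<Rightarrow> real"
  assumes "is_vector_norm \<nu>"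
  shows "\<nu> (A *v x) \<le> induced_norm \<nu> A * \<nu> x"
proof (cases "x = 0")
  case True
  then show ?thesis
    using assms unfolding is_vector_norm_def by (metis matrix_vector_mult_0_right mult_zero_right order_refl)
next
  case False
  then have "\<nu> x > 0"
    using assms unfolding is_vector_norm_def by (metis order_less_le)
  moreover have "\<nu> (A *v x) / \<nu> x \<le> induced_norm \<nu> A"
    unfolding induced_norm_def by (rule cSUP_upper[OF UNIV_I induced_norm_bdd_above[OF assms]])
  ultimately show ?thesis
    by (simp add: divide_le_eq)
qed

text \<open>The zero vector puts \<open>0 / 0 = 0\<close> into the family whose supremum is
  taken.\<close>

lemma induced_norm_nonneg:
  fixes \<nu> :: "real ^ 'n::finite \<Rightarrow> real"
  assumes "is_vector_norm \<nu>"
  shows "0 \<le> induced_norm \<nu> A"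
proof -
  have "\<nu> (A *v 0) / \<nu> 0 \<le> induced_norm \<nu> A"
    unfolding induced_norm_def by (rule cSUP_upper[OF UNIV_I induced_norm_bdd_above[OF assms]])
  moreover have "\<nu> 0 = 0"
    using assms unfolding is_vector_norm_def by blast
  ultimately show ?thesis
    by simp
qed

lemma induced_norm_le:
  fixes \<nu> :: "real ^ 'n::finite \<Rightarrow> real"
  assumes "is_vector_norm \<nu>" "0 \<le> b" "\<And>x. \<nu> (A *v x) \<le> b * \<nu> x"
  shows "induced_norm \<nu> A \<le> b"
  unfolding induced_norm_def
proof (rule cSUP_least)
  fix x
  have "0 \<le> \<nu> x"
    using assms(1) unfolding is_vector_norm_def by blast
  then show "\<nu> (A *v x) / \<nu> x \<le> b"
    using assms(2) assms(3)[of x] by (cases "\<nu> x = 0") (auto simp: divide_le_eq)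
qed simp

lemma induced_norm_mult:
  fixes \<nu> :: "real ^ 'n::finite \<Rightarrow> real"
  assumes "is_vector_norm \<nu>"
  shows "induced_norm \<nu> (A ** B) \<le> induced_norm \<nu> A * induced_norm \<nu> B"
proof (rule induced_norm_le[OF assms])
  show "0 \<le> induced_norm \<nu> A * induced_norm \<nu> B"
    by (simp add: assms induced_norm_nonneg)
  fix x
  have "\<nu> (A *v (B *v x)) \<le> induced_norm \<nu> A * (induced_norm \<nu> B * \<nu> x)"
    using induced_norm_bound[OF assms] induced_norm_nonneg[OF assms]
    by (meson mult_left_mono order_trans)
  then show "\<nu> (A ** B *v x) \<le> induced_norm \<nu> A * induced_norm \<nu> B * \<nu> x"
    by (simp add: matrix_vector_mul_assoc mult.assoc)
qed

lemma induced_norm_scaleR_le: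
  fixes \<nu> :: "real ^ 'n::finite \<Rightarrow> real"
  assumes "is_vector_norm \<nu>"
  shows "induced_norm \<nu> (a *\<^sub>R A) \<le> \<bar>a\<bar> * induced_norm \<nu> A"
proof (rule induced_norm_le[OF assms])
  show "0 \<le> \<bar>a\<bar> * induced_norm \<nu> A"
    by (simp add: assms induced_norm_nonneg)
  fix x
  have "\<nu> (a *\<^sub>R A *v x) = \<bar>a\<bar> * \<nu> (A *v x)"
    using assms unfolding is_vector_norm_def by (simp add: scaleR_matrix_vector_assoc[symmetric])
  then show "\<nu> (a *\<^sub>R A *v x) \<le> \<bar>a\<bar> * induced_norm \<nu> A * \<nu> x"
    using induced_norm_bound[OF assms, of A x] by (simp add: mult.assoc mult_left_mono)
qed

lemma induced_norm_mat_1_le: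
  fixes \<nu> :: "real ^ 'n::finite \<Rightarrow> real"
  assumes "is_vector_norm \<nu>"
  shows "induced_norm \<nu> (mat 1) \<le> 1"
  by (rule induced_norm_le[OF assms]) auto

text \<open>Passes from estimates in the induced norm to the topology of the matrix type, in which
  series are summed. The entry at \<open>i\<close>, \<open>j\<close> is a coordinate of the image of
  the basis vector \<open>axis j 1\<close>, so the induced norm dominates it up to a
  constant.\<close>

lemma induced_norm_tendsto_zero_imp:
  fixes \<nu> :: "real ^ 'n::finite \<Rightarrow> real"
  assumes \<nu>: "is_vector_norm \<nu>" and lim: "(\<lambda>n. induced_norm \<nu> (X n)) \<longlonglongrightarrow> 0"
  shows "X \<longlonglongrightarrow> 0"
proof -
  obtain c where c: "c > 0" "\<And>x. c * norm x \<le> \<nu> x"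
    using is_vector_norm_equivalent[OF \<nu>] by blast
  have "(\<lambda>n. X n $ i $ j) \<longlonglongrightarrow> 0" for i j
  proof (rule Lim_null_comparison)
    let ?e = "axis j 1 :: real ^ 'n"
    show "\<forall>\<^sub>F n in sequentially. norm (X n $ i $ j) \<le> induced_norm \<nu> (X n) * \<nu> ?e / c"
    proof (rule always_eventually, rule allI)
      fix n
      have "norm (X n $ i $ j) = norm ((X n *v ?e) $ i)"
        by (simp add: matrix_vector_mult_basis column_def)
      also have "\<dots> \<le> norm (X n *v ?e)"
        by (rule Finite_Cartesian_Product.norm_nth_le)
      also have "\<dots> \<le> \<nu> (X n *v ?e) / c"
        using c by (simp add: pos_le_divide_eq mult.commute)
      also have "\<dots> \<le> induced_norm \<nu> (X n) * \<nu> ?e / c"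
        using c(1) induced_norm_bound[OF \<nu>] by (simp add: divide_right_mono)
      finally show "norm (X n $ i $ j) \<le> induced_norm \<nu> (X n) * \<nu> ?e / c" .
    qed
    show "(\<lambda>n. induced_norm \<nu> (X n) * \<nu> ?e / c) \<longlonglongrightarrow> 0"
      using tendsto_mult_left_zero[OF lim, of "\<nu> ?e / c"] by simp
  qed
  then show ?thesis
    by (intro vec_tendstoI) simp
qed

section \<open>Matrix powers and Neumann series\<close>

text \<open>In finite dimension bilinear maps are bounded. This yields continuity of the product as
  well as its rules for differences and scalars.\<close>

lemma bounded_bilinear_matrix_mult:
  "bounded_bilinear ((**) :: real ^ 'n::finite ^ 'm::finite \<Rightarrow> real ^ 'k::finite ^ 'n \<Rightarrow> _)"
  by (simp add: bilinear_conv_bounded_bilinear[symmetric] bilinear_def linear_iff matrix_add_ldistrib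
      matrix_scalar_ac scalar_matrix_assoc)
    (simp add: matrix_matrix_mult_def vec_eq_iff sum.distrib distrib_right)

lemma bounded_bilinear_matrix_vector_mult:
  "bounded_bilinear ((*v) :: real ^ 'n::finite ^ 'm::finite \<Rightarrow> _)"
  by (simp add: bilinear_conv_bounded_bilinear[symmetric] bilinear_def linear_iff
      matrix_vector_mult_add_rdistrib matrix_vector_right_distrib scaleR_matrix_vector_assoc
      matrix_vector_mult_scaleR)

lemmas matrix_mult_diff_left = bounded_bilinear.diff_left[OF bounded_bilinear_matrix_mult]
lemmas matrix_mult_diff_right = bounded_bilinear.diff_right[OF bounded_bilinear_matrix_mult]
lemmas matrix_mult_scaleR_left = bounded_bilinear.scaleR_left[OF bounded_bilinear_matrix_mult]
lemmas matrix_mult_scaleR_right = bounded_bilinear.scaleR_right[OF bounded_bilinear_matrix_mult]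

section \<open>Powers of a matrix\<close>

lemma matrix_power_0 [simp]: "matrix_power A 0 = mat 1"
  by (simp add: matrix_power_def)

lemma matrix_power_Suc [simp]: "matrix_power A (Suc n) = A ** matrix_power A n"
  by (simp add: matrix_power_def)

lemma matrix_power_scaleR:
  fixes A :: "real ^ 'n::finite ^ 'n"
  shows "matrix_power (c *\<^sub>R A) n = c ^ n *\<^sub>R matrix_power A n"
  by (induction n)
    (simp_all add: matrix_mult_scaleR_left matrix_mult_scaleR_right)

text \<open>In a power of \<open>G ** D\<close> every \<open>G\<close> except the leftmost stands
  between two factors \<open>D\<close>, where it may be exchanged for \<open>G'\<close>.\<close>

lemma matrix_power_sandwich:
  fixes G G' D :: "real ^ 'n::finite ^ 'n"
  assumes "D ** G ** D = D ** G' ** D"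
  shows "matrix_power (G ** D) (Suc n) = G ** D ** matrix_power (G' ** D) n"
proof (induction n)
  case (Suc n)
  \<comment> \<open>Only the outermost factor is unfolded, so that the induction hypothesis for
    \<open>Suc n\<close> still matches.\<close>
  have "matrix_power (G ** D) (Suc (Suc n)) = G ** D ** (G ** D ** matrix_power (G' ** D) n)"
    using Suc by (simp del: matrix_power_Suc add: matrix_power_Suc[of _ "Suc n"])
  also have "\<dots> = G ** (D ** G ** D) ** matrix_power (G' ** D) n"
    by (simp add: matrix_mul_assoc)
  also have "\<dots> = G ** D ** matrix_power (G' ** D) (Suc n)"
    unfolding assms by (simp add: matrix_mul_assoc)
  finally show ?case .
qed simp

lemma induced_norm_matrix_power_le:
  fixes \<nu> :: "real ^ 'n::finite \<Rightarrow> real"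
  assumes "is_vector_norm \<nu>"
  shows "induced_norm \<nu> (matrix_power A n) \<le> induced_norm \<nu> A ^ n"
proof (induction n)
  case (Suc n)
  have "induced_norm \<nu> (A ** matrix_power A n) \<le> induced_norm \<nu> A * induced_norm \<nu> (matrix_power A n)"
    by (rule induced_norm_mult[OF assms])
  also have "\<dots> \<le> induced_norm \<nu> A * induced_norm \<nu> A ^ n"
    by (rule mult_left_mono[OF Suc induced_norm_nonneg[OF assms]])
  finally show ?case
    by simp
qed (simp add: induced_norm_mat_1_le[OF assms])

text \<open>The geometric sum telescopes.\<close>

lemma sum_matrix_power:
  fixes K :: "real ^ 'n::finite ^ 'n"
  shows "(mat 1 - K) ** (\<Sum>n<N. matrix_power K n) = mat 1 - matrix_power K N"
proof (induction N)
  case (Suc N)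
  have "(mat 1 - K) ** (\<Sum>n<Suc N. matrix_power K n)
      = (mat 1 - matrix_power K N) + (mat 1 - K) ** matrix_power K N"
    by (simp add: matrix_add_ldistrib Suc)
  also have "(mat 1 - K) ** matrix_power K N = matrix_power K N - K ** matrix_power K N"
    by (simp add: matrix_mult_diff_left)
  finally show ?case
    by simp
qed simp

lemma sum_matrix_power_eq:
  fixes K R :: "real ^ 'n::finite ^ 'n"
  assumes "R ** (mat 1 - K) = mat 1"
  shows "(\<Sum>n<N. matrix_power K n) = R - R ** matrix_power K N"
proof -
  have "(\<Sum>n<N. matrix_power K n) = R ** (mat 1 - K) ** (\<Sum>n<N. matrix_power K n)"
    by (simp add: assms)
  also have "\<dots> = R ** (mat 1 - matrix_power K N)"
    by (simp add: matrix_mul_assoc[symmetric] sum_matrix_power)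
  finally show ?thesis
    by (simp add: matrix_mult_diff_right)
qed

text \<open>A vector in the kernel of \<open>mat 1 - K\<close> is fixed by \<open>K\<close>, hence
  by all its powers, and these tend to \<open>0\<close>. The assumption is on the powers because the
  norm of the \<open>K\<close> in the application need not be below 1.\<close>

lemma Neumann_left_inverse:
  fixes K :: "real ^ 'n::finite ^ 'n"
  assumes "(\<lambda>n. matrix_power K n) \<longlonglongrightarrow> 0"
  obtains R where "R ** (mat 1 - K) = mat 1"
proof -
  have "x = 0" if "(mat 1 - K) *v x = 0" for x
  proof -
    have K: "K *v x = x"
      using that by (simp add: bounded_bilinear.diff_left[OF bounded_bilinear_matrix_vector_mult])
    have fixed: "matrix_power K n *v x = x" for n
      by (induction n) (simp_all add: matrix_vector_mul_assoc[symmetric] K)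
    have "(\<lambda>n. matrix_power K n *v x) \<longlonglongrightarrow> 0 *v x"
      by (rule bounded_bilinear.tendsto[OF bounded_bilinear_matrix_vector_mult assms tendsto_const])
    then show "x = 0"
      using LIMSEQ_unique by (fastforce simp: fixed)
  qed
  then show thesis
    using that matrix_left_invertible_ker[of "mat 1 - K"] by blast
qed

lemma Neumann_series:
  fixes K R :: "real ^ 'n::finite ^ 'n"
  assumes "(\<lambda>n. matrix_power K n) \<longlonglongrightarrow> 0" "R ** (mat 1 - K) = mat 1"
  shows "(\<lambda>n. matrix_power K n) sums R"
proof -
  have "(\<lambda>N. R ** matrix_power K N) \<longlonglongrightarrow> R ** 0"
    by (rule bounded_bilinear.tendsto[OF bounded_bilinear_matrix_mult tendsto_const assms(1)])
  then have "(\<lambda>N. R - R ** matrix_power K N) \<longlonglongrightarrow> R - 0"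
    by (intro tendsto_diff tendsto_const) simp
  then show ?thesis
    by (simp add: sums_def sum_matrix_power_eq[OF assms(2)])
qed

section \<open>Inverses and diagonal matrices\<close>

lemma matrix_inv_inverse:
  assumes "invertible A"
  shows "A ** matrix_inv A = mat 1" "matrix_inv A ** A = mat 1"
  using someI_ex[OF assms[unfolded invertible_def]] by (simp_all add: matrix_inv_def)

lemma diagonal_matrix_mult:
  fixes A :: "real ^ 'n::finite ^ 'n"
  shows "diagonal_matrix d ** A = (\<chi> i j. d i * A $ i $ j)"
  by (simp_all add: diagonal_matrix_def matrix_matrix_mult_def vec_eq_iff if_distrib if_distribR
      sum.delta cong: if_cong)

theorem proposition4:
  fixes \<Gamma> :: "'a pair_pre_digraph"
    and V \<Lambda> :: "'a set"
    and v :: "'n::finite \<Rightarrow> 'a"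
    and \<alpha>\<^sub>0 t \<eta>\<^sub>m\<^sub>a\<^sub>x :: real
    and \<eta> :: "'a \<Rightarrow> real"
    and \<nu> :: "real ^ 'n \<Rightarrow> real"
    and H\<^sub>0 G\<^sub>0 D\<^sub>\<eta> H I\<^sub>\<Lambda> G\<^sub>0\<^sub>\<Lambda> B :: "real ^ 'n ^ 'n"
    and B\<^sub>N :: "nat \<Rightarrow> real ^ 'n ^ 'n"
  assumes graph: "pair_bidirected_digraph \<Gamma>" "Digraph_Component.connected (with_proj \<Gamma>)"
      "locally_finite \<Gamma>"
    and V: "V \<noteq> {}" "V \<subset> pverts \<Gamma>" "finite V" "finite (vertex_boundary \<Gamma> V)"
    and v: "bij_betw v UNIV (V \<union> vertex_boundary \<Gamma> V)"
    and params: "\<alpha>\<^sub>0 > 0" "t \<ge> 0"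
    and H0: "H\<^sub>0 = laplacian_matrix (boundary_graph \<Gamma> V) v
                     + diagonal_matrix (\<lambda>i. if v i \<in> V then \<alpha>\<^sub>0 else t)"
      "invertible H\<^sub>0"
    and G0: "G\<^sub>0 = matrix_inv H\<^sub>0"
    and eta: "\<And>x. x \<in> V \<Longrightarrow> \<eta> x \<ge> 0"
    and D: "D\<^sub>\<eta> = diagonal_matrix (\<lambda>i. if v i \<in> V then \<eta> (v i) else 0)"
    and H: "H = H\<^sub>0 + \<alpha>\<^sub>0 *\<^sub>R D\<^sub>\<eta>"
    and norm: "is_vector_norm \<nu>"
      "\<And>d. induced_norm \<nu> (diagonal_matrix d) = Max (range (\<lambda>i. \<bar>d i\<bar>))"
    and support: "\<Lambda> = {x \<in> V. \<eta> x \<noteq> 0}"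
    and I: "I\<^sub>\<Lambda> = diagonal_matrix (\<lambda>i. if v i \<in> \<Lambda> then 1 else 0)"
    and G0\<Lambda>: "G\<^sub>0\<^sub>\<Lambda> = I\<^sub>\<Lambda> ** G\<^sub>0 ** I\<^sub>\<Lambda>"
    and etamax: "\<eta>\<^sub>m\<^sub>a\<^sub>x = sup_on \<Lambda> \<eta>"
    and small: "\<eta>\<^sub>m\<^sub>a\<^sub>x * \<alpha>\<^sub>0 * induced_norm \<nu> G\<^sub>0\<^sub>\<Lambda> < 1"
    and B: "B = (\<Sum>n. ((-1) ^ n * \<alpha>\<^sub>0 ^ n) *\<^sub>R matrix_power (G\<^sub>0 ** D\<^sub>\<eta>) n) ** G\<^sub>0"
    and BN: "\<And>N. B\<^sub>N N = (\<Sum>n\<le>N. ((-1) ^ n * \<alpha>\<^sub>0 ^ n) *\<^sub>R matrix_power (G\<^sub>0 ** D\<^sub>\<eta>) n) ** G\<^sub>0"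
  shows "summable (\<lambda>n. ((-1) ^ n * \<alpha>\<^sub>0 ^ n) *\<^sub>R matrix_power (G\<^sub>0 ** D\<^sub>\<eta>) n)
     \<and> invertible H \<and> B = matrix_inv H
     \<and> (\<lambda>N. induced_norm \<nu> (B - B\<^sub>N N))
         \<in> O(\<lambda>N. \<alpha>\<^sub>0 ^ N * induced_norm \<nu> G\<^sub>0\<^sub>\<Lambda> ^ N * \<eta>\<^sub>m\<^sub>a\<^sub>x ^ N)"
proof -
  define K where "K = (- \<alpha>\<^sub>0) *\<^sub>R (G\<^sub>0 ** D\<^sub>\<eta>)"
  define r where "r = \<alpha>\<^sub>0 * induced_norm \<nu> G\<^sub>0\<^sub>\<Lambda> * \<eta>\<^sub>m\<^sub>a\<^sub>x"
  \<comment> \<open>The constant \<open>c\<close> accounts for the leftmost factor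
    \<open>G\<^sub>0 ** D\<^sub>\<eta>\<close>, whose \<open>G\<^sub>0\<close> is not enclosed by
    two factors \<open>D\<^sub>\<eta>\<close>.\<close>
  define c where "c = \<alpha>\<^sub>0 * induced_norm \<nu> (G\<^sub>0 ** D\<^sub>\<eta>)"
  note nonneg = induced_norm_nonneg[OF norm(1)]
  have finL: "finite \<Lambda>"
    using V(3) support by simp
  \<comment> \<open>Finiteness of \<open>\<Lambda>\<close> makes the supremum a genuine upper
    bound.\<close>
  have eta_le: "\<eta> x \<le> \<eta>\<^sub>m\<^sub>a\<^sub>x" if "x \<in> \<Lambda>" for x
    using that finL unfolding etamax sup_on_def by (auto intro: cSUP_upper)
  have etamax0: "0 \<le> \<eta>\<^sub>m\<^sub>a\<^sub>x"
  proof (cases "\<Lambda> = {}")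
    case False
    then obtain x where "x \<in> \<Lambda>" by blast
    then show ?thesis
      using eta_le[of x] eta[of x] support by auto
  qed (simp add: etamax sup_on_def)
  \<comment> \<open>The norm of a diagonal matrix is its largest absolute entry; entries at vertices
    off \<open>\<Lambda>\<close> are \<open>0\<close>, hence the appeal to
    \<open>etamax0\<close>.\<close>
  have D_le: "induced_norm \<nu> D\<^sub>\<eta> \<le> \<eta>\<^sub>m\<^sub>a\<^sub>x"
  proof -
    have "\<bar>if v i \<in> V then \<eta> (v i) else 0\<bar> \<le> \<eta>\<^sub>m\<^sub>a\<^sub>x" for i
      using eta_le[of "v i"] eta[of "v i"] etamax0 support by (cases "\<eta> (v i) = 0") auto
    then show ?thesis
      unfolding D norm(2) by (intro Max.boundedI) auto
  qed
  have r0: "0 \<le> r" and r1: "r < 1" and c0: "0 \<le> c"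
    using small params(1) etamax0 nonneg by (simp_all add: r_def c_def mult_ac)
  \<comment> \<open>The cut-off \<open>I\<^sub>\<Lambda>\<close> is the identity on the support of
    \<open>\<eta>\<close>, so \<open>D\<^sub>\<eta>\<close> absorbs it on either side.\<close>
  have DID: "D\<^sub>\<eta> ** I\<^sub>\<Lambda> = D\<^sub>\<eta>" "I\<^sub>\<Lambda> ** D\<^sub>\<eta> = D\<^sub>\<eta>"
    unfolding D I diagonal_matrix_mult by (auto simp: diagonal_matrix_def vec_eq_iff support)
  have "D\<^sub>\<eta> ** G\<^sub>0\<^sub>\<Lambda> ** D\<^sub>\<eta> = (D\<^sub>\<eta> ** I\<^sub>\<Lambda>) ** G\<^sub>0 ** (I\<^sub>\<Lambda> ** D\<^sub>\<eta>)"
    unfolding G0\<Lambda> by (simp only: matrix_mul_assoc)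
  then have DGD: "D\<^sub>\<eta> ** G\<^sub>0 ** D\<^sub>\<eta> = D\<^sub>\<eta> ** G\<^sub>0\<^sub>\<Lambda> ** D\<^sub>\<eta>"
    unfolding DID by simp
  have K_power: "matrix_power K n = ((-1) ^ n * \<alpha>\<^sub>0 ^ n) *\<^sub>R matrix_power (G\<^sub>0 ** D\<^sub>\<eta>) n" for n
    unfolding K_def matrix_power_scaleR by (simp add: power_mult_distrib[symmetric])
  \<comment> \<open>One factor \<open>\<alpha>\<^sub>0\<close> and the leftmost block go into
    \<open>c\<close>; each of the other \<open>n\<close> blocks contributes a factor
    \<open>r\<close>.\<close>
  have K_le: "induced_norm \<nu> (matrix_power K (Suc n)) \<le> c * r ^ n" for n
  proof -
    have "induced_norm \<nu> (matrix_power K (Suc n))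
        \<le> \<bar>(- \<alpha>\<^sub>0) ^ Suc n\<bar> * induced_norm \<nu> (matrix_power (G\<^sub>0 ** D\<^sub>\<eta>) (Suc n))"
      unfolding K_def matrix_power_scaleR by (rule induced_norm_scaleR_le[OF norm(1)])
    also have "\<bar>(- \<alpha>\<^sub>0) ^ Suc n\<bar> = \<alpha>\<^sub>0 ^ Suc n"
      using params(1) by (simp add: power_abs abs_mult)
    also have "induced_norm \<nu> (matrix_power (G\<^sub>0 ** D\<^sub>\<eta>) (Suc n))
        \<le> induced_norm \<nu> (G\<^sub>0 ** D\<^sub>\<eta>) * (induced_norm \<nu> G\<^sub>0\<^sub>\<Lambda> * \<eta>\<^sub>m\<^sub>a\<^sub>x) ^ n"
    proof -
      have "induced_norm \<nu> (G\<^sub>0\<^sub>\<Lambda> ** D\<^sub>\<eta>) \<le> induced_norm \<nu> G\<^sub>0\<^sub>\<Lambda> * \<eta>\<^sub>m\<^sub>a\<^sub>x"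
        using induced_norm_mult[OF norm(1), of "G\<^sub>0\<^sub>\<Lambda>" "D\<^sub>\<eta>"] mult_left_mono[OF D_le nonneg[of "G\<^sub>0\<^sub>\<Lambda>"]]
        by linarith
      then have "induced_norm \<nu> (matrix_power (G\<^sub>0\<^sub>\<Lambda> ** D\<^sub>\<eta>) n) \<le> (induced_norm \<nu> G\<^sub>0\<^sub>\<Lambda> * \<eta>\<^sub>m\<^sub>a\<^sub>x) ^ n"
        using induced_norm_matrix_power_le[OF norm(1)] nonneg by (meson order_trans power_mono)
      then show ?thesis
        unfolding matrix_power_sandwich[OF DGD]
        using induced_norm_mult[OF norm(1)] nonneg by (meson mult_left_mono order_trans)
    qed
    finally show ?thesis
      using params(1) by (simp add: c_def r_def power_mult_distrib mult_ac)
  qed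

  \<comment> \<open>Convergence of the series to the inverse of the perturbed matrix\<close>
  have "(\<lambda>n. induced_norm \<nu> (matrix_power K (Suc n))) \<longlonglongrightarrow> 0"
  proof (rule Lim_null_comparison)
    show "\<forall>\<^sub>F n in sequentially. norm (induced_norm \<nu> (matrix_power K (Suc n))) \<le> c * r ^ n"
      using K_le nonneg by simp
    show "(\<lambda>n. c * r ^ n) \<longlonglongrightarrow> 0"
      using LIMSEQ_realpow_zero[OF r0 r1] by (rule tendsto_mult_right_zero)
  qed
  \<comment> \<open>The estimate concerns the powers from the first on; shifting the index does not
    change the limit.\<close>
  then have K_lim: "(\<lambda>n. matrix_power K n) \<longlonglongrightarrow> 0"
    by (intro LIMSEQ_imp_Suc[OF induced_norm_tendsto_zero_imp[OF norm(1)]])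
  obtain R where R: "R ** (mat 1 - K) = mat 1"
    using Neumann_left_inverse[OF K_lim] .
  have sums: "(\<lambda>n. ((-1) ^ n * \<alpha>\<^sub>0 ^ n) *\<^sub>R matrix_power (G\<^sub>0 ** D\<^sub>\<eta>) n) sums R"
    using Neumann_series[OF K_lim R] by (simp only: K_power)
  have B_eq: "B = R ** G\<^sub>0"
    unfolding B using sums_unique[OF sums] by simp
  have G0_inv: "H\<^sub>0 ** G\<^sub>0 = mat 1" "G\<^sub>0 ** H\<^sub>0 = mat 1"
    using matrix_inv_inverse[OF H0(2)] by (simp_all add: G0)
  \<comment> \<open>Since \<open>H\<^sub>0 ** G\<^sub>0\<close> is the identity, multiplying by
    \<open>H\<^sub>0\<close> turns \<open>- K\<close> back into the perturbation
    \<open>\<alpha>\<^sub>0 *\<^sub>R D\<^sub>\<eta>\<close>.\<close>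
  have "H\<^sub>0 ** (mat 1 - K) = H\<^sub>0 + \<alpha>\<^sub>0 *\<^sub>R (H\<^sub>0 ** G\<^sub>0 ** D\<^sub>\<eta>)"
    by (simp add: K_def matrix_add_ldistrib matrix_mul_assoc matrix_mult_scaleR_right)
  then have H_eq: "H = H\<^sub>0 ** (mat 1 - K)"
    by (simp add: G0_inv H)
  have "B ** H = R ** (G\<^sub>0 ** H\<^sub>0) ** (mat 1 - K)"
    unfolding B_eq H_eq by (simp only: matrix_mul_assoc)
  then have BH: "B ** H = mat 1"
    by (simp add: G0_inv R)
  \<comment> \<open>For square matrices a left inverse is also a right inverse.\<close>
  then have HB: "H ** B = mat 1"
    using matrix_left_right_inverse by blast
  have invH: "invertible H"
    using BH HB unfolding invertible_def by blast
  have "B = B ** (H ** matrix_inv H)"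
    by (simp add: matrix_inv_inverse(1)[OF invH])
  then have B_inv: "B = matrix_inv H"
    by (simp add: matrix_mul_assoc BH)
  \<comment> \<open>The partial sum includes the index \<open>N\<close>, so the remainder carries
    the power \<open>Suc N\<close>; as \<open>K_le\<close> loses one factor, exactly
    \<open>r ^ N\<close> is left.\<close>
  have remainder: "B - B\<^sub>N N = R ** matrix_power K (Suc N) ** G\<^sub>0" for N
  proof -
    have "B\<^sub>N N = (R - R ** matrix_power K (Suc N)) ** G\<^sub>0"
      unfolding BN K_power[symmetric] using sum_matrix_power_eq[OF R, of "Suc N"]
      by (simp only: lessThan_Suc_atMost)
    then show ?thesis
      by (simp add: B_eq matrix_mult_diff_left)
  qed
  \<comment> \<open>The bound holds for every \<open>N\<close>, with constant \<open>?C\<close> free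
    of \<open>N\<close>. For \<open>r = 0\<close> it says that the error vanishes from
    \<open>N = 1\<close> on.\<close>
  have "(\<lambda>N. induced_norm \<nu> (B - B\<^sub>N N)) \<in> O(\<lambda>N. r ^ N)"
  proof (rule bigoI, rule always_eventually, rule allI)
    fix N
    let ?C = "induced_norm \<nu> R * c * induced_norm \<nu> G\<^sub>0"
    have "induced_norm \<nu> (B - B\<^sub>N N)
        \<le> induced_norm \<nu> R * induced_norm \<nu> (matrix_power K (Suc N)) * induced_norm \<nu> G\<^sub>0"
      unfolding remainder using induced_norm_mult[OF norm(1)] nonneg
      by (meson mult_right_mono order_trans)
    also have "\<dots> \<le> induced_norm \<nu> R * (c * r ^ N) * induced_norm \<nu> G\<^sub>0"
      by (intro mult_right_mono mult_left_mono K_le nonneg)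
    finally show "norm (induced_norm \<nu> (B - B\<^sub>N N)) \<le> ?C * norm (r ^ N)"
      using nonneg r0 by (simp add: mult_ac)
  qed
  then show ?thesis
    using sums_summable[OF sums] invH B_inv by (simp add: r_def power_mult_distrib)
qed

end
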